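(* Let $K$ be a simplicial complex on the vertex set $[m]=\{1,\ldots,m\}$. There is a $T^m$-equivariant deformation retraction $U(K)\to\mathcal Z_K$ of the complement $U(K)$ of the complex coordinate subspace arrangement defined by $K$ onto the moment-angle complex $\mathcal Z_K\subset U(K)$.
   Context: $K$ is a finite abstract simplicial complex on $[m]$ with $\emptyset\in K$ and $\{i\}\in K$ for all $i\in[m]$. The arrangement complement is $$U(K)=\mathbb C^m\setminus\bigcup_{I\subset[m],\,I\notin K}\{(z_1,\ldots,z_m)\in\mathbb C^m : z_i=0\text{ for all }i\in I\},$$ and, with $D^2=\{z\in\mathbb C:|z|\le1\}$, $$\mathcal Z_K=\bigcup_{I\in K}\{(z_1,\ldots,z_m)\in(D^2)^m : |z_i|=1\text{ for }i\notin I\}.$$ One has $\mathcal Z_K\subset U(K)$. The torus $T^m=(S^1)^m$ acts on both spaces by coordinatewise multiplication. *)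

theory Defs
  imports "HOL-Analysis.Analysis"
begin

(* The finite type 'n plays the role of [m], so that m = CARD('n) and C^m = complex^'n. *)

definition abstract_simplicial_complex :: "'n set set \<Rightarrow> bool" where
  "abstract_simplicial_complex K \<longleftrightarrow>
     {} \<in> K \<and> (\<forall>i. {i} \<in> K) \<and> (\<forall>I\<in>K. \<forall>J. J \<subseteq> I \<longrightarrow> J \<in> K)"

definition arrangement_complement :: "'n set set \<Rightarrow> (complex ^ 'n) set" where
  "arrangement_complement K = UNIV - (\<Union>I\<in>{I. I \<notin> K}. {z. \<forall>i\<in>I. z $ i = 0})"

definition moment_angle_complex :: "'n set set \<Rightarrow> (complex ^ 'n) set" where
  "moment_angle_complex K =
     (\<Union>I\<in>K. {z. (\<forall>i. norm (z $ i) \<le> 1) \<and> (\<forall>i. i \<notin> I \<longrightarrow> norm (z $ i) = 1)})"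

(* Multiplication on complex ^ 'n is componentwise, so t * z with t in torus is the
   coordinatewise action of T^m. *)
definition torus :: "(complex ^ 'n) set" where
  "torus = {t. \<forall>i. norm (t $ i) = 1}"

definition equivariant_on :: "'g set \<Rightarrow> ('g \<Rightarrow> 'a \<Rightarrow> 'a) \<Rightarrow> 'a set \<Rightarrow> ('a \<Rightarrow> 'a) \<Rightarrow> bool" where
  "equivariant_on G act X f \<longleftrightarrow> (\<forall>g\<in>G. \<forall>x\<in>X. f (act g x) = act g (f x))"

(* The predicate in homotopic_with is imposed on the map at every time t in [0,1]: the
   homotopy from the identity of X to r is through equivariant maps X -> X and is
   stationary on A (deformation retraction in the strong sense).  At t = 1 this gives in
   particular that r itself is equivariant. *)
definition equivariant_deformation_retraction ::
  "'g set \<Rightarrow> ('g \<Rightarrow> 'a \<Rightarrow> 'a) \<Rightarrow> 'a::topological_space set \<Rightarrow> 'a set \<Rightarrow> ('a \<Rightarrow> 'a) \<Rightarrow> bool" where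
  "equivariant_deformation_retraction G act X A r \<longleftrightarrow>
     retraction X A r \<and>
     homotopic_with_canon (\<lambda>f. equivariant_on G act X f \<and> (\<forall>x\<in>A. f x = x)) X X id r"

lemma moment_angle_complex_subset:
  assumes "abstract_simplicial_complex K"
  shows "moment_angle_complex K \<subseteq> arrangement_complement K"
proof
  fix z assume "z \<in> moment_angle_complex K"
  then obtain I where I: "I \<in> K" "\<And>i. i \<notin> I \<Longrightarrow> norm (z $ i) = 1"
    by (auto simp: moment_angle_complex_def)
  have "J \<in> K" if J: "\<forall>i\<in>J. z $ i = 0" for J
  proof -
    have "J \<subseteq> I" using I(2) J by fastforce
    with I(1) assms show ?thesis by (auto simp: abstract_simplicial_complex_def)
  qed
  then show "z \<in> arrangement_complement K"
    by (auto simp: arrangement_complement_def)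
qed

lemma torus_times_arrangement_complement:
  assumes "t \<in> torus" "z \<in> arrangement_complement K"
  shows "t * z \<in> arrangement_complement K"
proof -
  have "t $ i \<noteq> 0" for i
    using assms(1) by (metis (mono_tags) mem_Collect_eq norm_zero torus_def zero_neq_one)
  then show ?thesis
    using assms(2) by (simp add: arrangement_complement_def)
qed

lemma torus_times_moment_angle_complex:
  assumes "t \<in> torus" "z \<in> moment_angle_complex K"
  shows "t * z \<in> moment_angle_complex K"
  using assms by (simp add: torus_def moment_angle_complex_def norm_mult)

end

theory Submission
  imports Defs
begin

text \<open>
  Only the moduli of the coordinates matter. Clamping the moduli at level \<open>c\<close> and rescaling,
  \<open>|z\<^sub>i| \<mapsto> min (|z\<^sub>i| / c) 1\<close>, lands in the moment-angle complex as soon as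
  \<open>{i. |z\<^sub>i| < c}\<close> is a face of \<open>K\<close>; the largest such \<open>c\<close> is the minimum over the nonfaces \<open>J\<close>
  of the maximum of \<open>|z\<^sub>i|\<close> over \<open>i \<in> J\<close>. This level is continuous, and it is positive exactly
  on the arrangement complement. Cutting it off at 1 makes the map the identity on the
  moment-angle complex. The map multiplies each coordinate by a positive factor that depends only
  on the moduli, so it is equivariant, and the straight-line homotopy preserves the zero pattern of
  every point.
\<close>

lemma continuous_on_Max_image:
  fixes f :: "'i \<Rightarrow> 'a::topological_space \<Rightarrow> 'b::linorder_topology"
  assumes "finite I" "I \<noteq> {}" "\<And>i. i \<in> I \<Longrightarrow> continuous_on S (f i)"
  shows "continuous_on S (\<lambda>x. Max ((\<lambda>i. f i x) ` I))"
  using assms by (induction I rule: finite_ne_induct) (simp_all add: continuous_on_max)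

lemma continuous_on_Min_image:
  fixes f :: "'i \<Rightarrow> 'a::topological_space \<Rightarrow> 'b::linorder_topology"
  assumes "finite I" "I \<noteq> {}" "\<And>i. i \<in> I \<Longrightarrow> continuous_on S (f i)"
  shows "continuous_on S (\<lambda>x. Min ((\<lambda>i. f i x) ` I))"
  using assms by (induction I rule: finite_ne_induct) (simp_all add: continuous_on_min)

text \<open>Inserting 1 also keeps the minimum over a nonempty set when every subset is a
  face.\<close>

definition level :: "'n::finite set set \<Rightarrow> complex ^ 'n \<Rightarrow> real" where
  "level K z = Min (insert 1 ((\<lambda>J. MAX i\<in>J. norm (z $ i)) ` (- K)))"

lemma level_le_1: "level K z \<le> 1"
  by (simp add: level_def)

text \<open>A nonface is nonempty because \<open>{}\<close> is a face, so each inner maximum is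
  attained.\<close>

lemma le_level_iff:
  assumes "{} \<in> K"
  shows "c \<le> level K z \<longleftrightarrow> c \<le> 1 \<and> (\<forall>J. J \<notin> K \<longrightarrow> (\<exists>i\<in>J. c \<le> norm (z $ i)))"
proof -
  have "c \<le> (MAX i\<in>J. norm (z $ i)) \<longleftrightarrow> (\<exists>i\<in>J. c \<le> norm (z $ i))" if "J \<notin> K" for J
    using that assms by (subst Max_ge_iff) auto
  then show ?thesis
    by (auto simp: level_def)
qed

lemma level_pos:
  assumes "{} \<in> K" "z \<in> arrangement_complement K"
  shows "0 < level K z"
proof -
  have "0 < (MAX i\<in>J. norm (z $ i))" if "J \<notin> K" for J
    using that assms by (subst Max_gr_iff) (auto simp: arrangement_complement_def)
  then show ?thesis
    by (auto simp: level_def)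
qed

text \<open>If this set were a nonface, \<open>le_level_iff\<close> at \<open>c = level K z\<close>
  would give it an element whose modulus is at least the level.\<close>

lemma level_face:
  assumes "{} \<in> K"
  shows "{i. norm (z $ i) < level K z} \<in> K"
  using le_level_iff[OF assms, of "level K z" z] by fastforce

lemma level_eq_1:
  assumes "abstract_simplicial_complex K" "z \<in> moment_angle_complex K"
  shows "level K z = 1"
proof -
  obtain I where I: "I \<in> K" "\<And>i. i \<notin> I \<Longrightarrow> norm (z $ i) = 1"
    using assms(2) by (auto simp: moment_angle_complex_def)
  have "\<exists>i\<in>J. 1 \<le> norm (z $ i)" if "J \<notin> K" for J
  proof -
    \<comment> \<open>Faces are closed under subsets, so a nonface has an element outside
      \<open>I\<close>, where the modulus is 1.\<close>
    have "\<not> J \<subseteq> I"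
      using that I(1) assms(1) by (auto simp: abstract_simplicial_complex_def)
    then show ?thesis
      using I(2) by force
  qed
  moreover have "{} \<in> K"
    using assms(1) by (simp add: abstract_simplicial_complex_def)
  ultimately show ?thesis
    using le_level_iff[of K 1 z] level_le_1[of K z] by auto
qed

lemma continuous_on_level:
  assumes "{} \<in> K"
  shows "continuous_on S (level K)"
proof -
  \<comment> \<open>Giving each face the value 1 makes the index set all of \<open>UNIV\<close>. The
    set of values stays the same since the face \<open>{}\<close> contributes the inserted
    1.\<close>
  have eq: "level K = (\<lambda>z. Min ((\<lambda>J. if J \<in> K then 1 else MAX i\<in>J. norm (z $ i)) ` UNIV))"
    (is "_ = (\<lambda>z. Min (?g z ` UNIV))")
  proof
    fix z
    have "?g z ` UNIV = insert 1 ((\<lambda>J. MAX i\<in>J. norm (z $ i)) ` (- K))"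
      using assms by (auto simp: image_iff)
    then show "level K z = Min (?g z ` UNIV)"
      by (simp add: level_def)
  qed
  have "continuous_on S (\<lambda>z. ?g z J)" for J
    using assms by (cases "J \<in> K") (auto intro!: continuous_on_Max_image continuous_intros)
  then have "continuous_on S (\<lambda>z. Min (?g z ` UNIV))"
    by (rule continuous_on_Min_image[OF finite_class.finite_UNIV UNIV_not_empty])
  then show ?thesis
    unfolding eq .
qed

lemma level_torus:
  assumes "t \<in> torus"
  shows "level K (t * z) = level K z"
  using assms by (simp add: level_def torus_def norm_mult)

text \<open>For a positive level, \<open>x / max c x\<close> equals \<open>min (x / c) 1\<close>.
  Written as a factor with a maximum in the denominator, it needs no case split and stays defined at
  zero coordinates.\<close>

definition clamp_homotopy :: "'n::finite set set \<Rightarrow> real \<Rightarrow> complex ^ 'n \<Rightarrow> complex ^ 'n" where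
  "clamp_homotopy K s z =
     (\<chi> i. of_real (1 - s + s / max (level K z) (norm (z $ i))) * z $ i)"

lemma clamp_homotopy_0: "clamp_homotopy K 0 z = z"
  by (simp add: clamp_homotopy_def vec_eq_iff)

lemma clamp_homotopy_in_complement:
  assumes "{} \<in> K" "z \<in> arrangement_complement K" "s \<in> {0..1}"
  shows "clamp_homotopy K s z \<in> arrangement_complement K"
proof -
  \<comment> \<open>For s < 1 the summand 1 - s is positive; at s = 1 it vanishes and the quotient
    alone is positive.\<close>
  have "1 - s + s / max (level K z) (norm (z $ i)) > 0" for i
  proof (cases "s = 1")
    case False
    then have "1 - s > 0"
      using assms(3) by simp
    moreover have "s / max (level K z) (norm (z $ i)) \<ge> 0"
      using assms(3) level_pos[OF assms(1,2)] by (simp add: max_def)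
    ultimately show ?thesis by simp
  qed (use level_pos[OF assms(1,2)] in \<open>simp add: less_max_iff_disj\<close>)
  then have "1 - s + s / max (level K z) (norm (z $ i)) \<noteq> 0" for i
    by (rule less_imp_neq[symmetric])
  then have "clamp_homotopy K s z $ i = 0 \<longleftrightarrow> z $ i = 0" for i
    by (simp only: clamp_homotopy_def vec_lambda_beta mult_eq_0_iff of_real_eq_0_iff simp_thms)
  then show ?thesis
    using assms(2) by (simp add: arrangement_complement_def)
qed

lemma clamp_homotopy_fixes:
  assumes "abstract_simplicial_complex K" "z \<in> moment_angle_complex K"
  shows "clamp_homotopy K s z = z"
proof -
  have "norm (z $ i) \<le> 1" for i
    using assms(2) by (auto simp: moment_angle_complex_def)
  then show ?thesis
    using level_eq_1[OF assms] by (simp add: clamp_homotopy_def vec_eq_iff max_absorb1)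
qed

lemma clamp_homotopy_1_in_moment_angle:
  assumes "{} \<in> K" "z \<in> arrangement_complement K"
  shows "clamp_homotopy K 1 z \<in> moment_angle_complex K"
proof -
  have pos: "0 < level K z"
    by (rule level_pos[OF assms])
  have eq: "norm (clamp_homotopy K 1 z $ i) = norm (z $ i) / max (level K z) (norm (z $ i))" for i
    using pos by (simp add: clamp_homotopy_def norm_mult norm_divide max_def)
  \<comment> \<open>The face from \<open>level_face\<close> will witness membership: outside it the
    maximum is the modulus itself, which is positive, so the quotient is 1.\<close>
  have "norm (clamp_homotopy K 1 z $ i) \<le> 1"
    and "\<not> norm (z $ i) < level K z \<Longrightarrow> norm (clamp_homotopy K 1 z $ i) = 1" for i
    using pos by (auto simp: eq max_def)
  then show ?thesis
    unfolding moment_angle_complex_def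
    by (intro UN_I[OF level_face[OF assms(1), of z]]) simp
qed

lemma clamp_homotopy_torus:
  assumes "t \<in> torus"
  shows "clamp_homotopy K s (t * z) = t * clamp_homotopy K s z"
  using assms
  by (simp add: clamp_homotopy_def level_torus vec_eq_iff)
     (simp add: torus_def norm_mult)

lemma continuous_on_clamp_homotopy:
  assumes "{} \<in> K"
  shows "continuous_on (T \<times> arrangement_complement K) (\<lambda>(s, z). clamp_homotopy K s z)"
proof -
  \<comment> \<open>Continuity of the quotient rests on the level being positive on the
    complement.\<close>
  have "max (level K (snd p)) (norm (snd p $ i)) \<noteq> 0"
    if "p \<in> T \<times> arrangement_complement K" for p i
    using that level_pos[OF assms, of "snd p"] by (auto simp: max_def)
  then show ?thesis
    unfolding clamp_homotopy_def case_prod_unfold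
    by (intro continuous_intros continuous_on_vec_lambda
        continuous_on_compose2[OF continuous_on_level[OF assms, of UNIV]]) auto
qed

theorem theorem5p2p5:
  fixes K :: "'n::finite set set"
  assumes "abstract_simplicial_complex K"
  shows "\<exists>r. equivariant_deformation_retraction torus (*)
               (arrangement_complement K) (moment_angle_complex K) r"
proof
  have K: "{} \<in> K"
    using assms by (simp add: abstract_simplicial_complex_def)
  let ?U = "arrangement_complement K" and ?h = "\<lambda>(s, z). clamp_homotopy K s z"
  have cont: "continuous_on ({0..1} \<times> ?U) ?h"
    by (rule continuous_on_clamp_homotopy[OF K])
  have "continuous_on ?U (\<lambda>z. ?h (1, z))"
    by (rule continuous_on_compose2[OF cont]) (auto intro!: continuous_intros)
  then have "retraction ?U (moment_angle_complex K) (clamp_homotopy K 1)"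
    using moment_angle_complex_subset[OF assms] clamp_homotopy_1_in_moment_angle[OF K]
      clamp_homotopy_fixes[OF assms]
    by (auto simp: retraction_def)
  moreover have "homotopic_with_canon
      (\<lambda>f. equivariant_on torus (*) ?U f \<and> (\<forall>x\<in>moment_angle_complex K. f x = x))
      ?U ?U id (clamp_homotopy K 1)"
    unfolding homotopic_with_def
  proof (intro exI[of _ ?h] conjI)
    show "continuous_map (prod_topology (top_of_set {0..1}) (top_of_set ?U)) (top_of_set ?U) ?h"
      using cont clamp_homotopy_in_complement[OF K]
      by auto
  qed (auto simp: clamp_homotopy_0 equivariant_on_def clamp_homotopy_torus
        clamp_homotopy_fixes[OF assms])
  ultimately show "equivariant_deformation_retraction torus (*) ?U (moment_angle_complex K)
      (clamp_homotopy K 1)"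
    by (simp add: equivariant_deformation_retraction_def)
qed

end
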